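(* Let $G$ be a connected graph on $n\geq 3$ vertices with Randić matrix $R$. If $G$ has no suspended paths, then $$RE(G)\leq \sqrt{n-1-\operatorname{null}(R)}\,\sqrt{n-2}\,\frac{\sqrt{2}}{2}+1.$$
   Context: Graphs are finite, simple and undirected. For a graph $G$ with vertex set $V$, edge set $E$ and vertex degrees $d_u$, the Randić matrix $R=[r_{uv}]$ is the real symmetric matrix indexed by $V$ with $r_{uv}=1/\sqrt{d_ud_v}$ if $uv\in E$ and $r_{uv}=0$ otherwise. The Randić energy is $RE(G)=\sum_{i=1}^n|\lambda_i|$, where $\lambda_1,\dots,\lambda_n$ are the eigenvalues of $R$ with multiplicity. $\operatorname{null}(R)$ denotes the dimension of the null space of $R$. A suspended path is a path $uvw$ in $G$ with $d_u=1$ and $d_v=2$ (i.e. $u$ is a pendent vertex whose neighbor has degree $2$). *)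

theory Defs
  imports "HOL-Analysis.Analysis" "HOL-Computational_Algebra.Polynomial"
begin

text \<open>
  A graph has as its vertex set all of a finite type \<open>'v\<close> and is given by its
  adjacency relation, so that matrices indexed by the vertex set are of type
  \<open>real ^ 'v ^ 'v\<close>. The number of vertices is \<open>CARD('v)\<close>.
\<close>

definition simple_graph :: "('v::finite \<Rightarrow> 'v \<Rightarrow> bool) \<Rightarrow> bool" where
  "simple_graph E \<longleftrightarrow> symp E \<and> irreflp E"

definition connected_graph :: "('v::finite \<Rightarrow> 'v \<Rightarrow> bool) \<Rightarrow> bool" where
  "connected_graph E \<longleftrightarrow> (\<forall>u v. E\<^sup>*\<^sup>* u v)"

definition degree :: "('v::finite \<Rightarrow> 'v \<Rightarrow> bool) \<Rightarrow> 'v \<Rightarrow> nat" where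
  "degree E u = card {v. E u v}"

definition suspended_path :: "('v::finite \<Rightarrow> 'v \<Rightarrow> bool) \<Rightarrow> 'v \<Rightarrow> 'v \<Rightarrow> 'v \<Rightarrow> bool" where
  "suspended_path E u v w \<longleftrightarrow>
     distinct [u, v, w] \<and> E u v \<and> E v w \<and> degree E u = 1 \<and> degree E v = 2"

definition randic_matrix :: "('v::finite \<Rightarrow> 'v \<Rightarrow> bool) \<Rightarrow> real ^ 'v ^ 'v" where
  "randic_matrix E =
     (\<chi> u v. if E u v then 1 / sqrt (real (degree E u) * real (degree E v)) else 0)"

text \<open>\<open>mat [:0, 1:]\<close> is the polynomial variable times the identity matrix.\<close>

definition charpoly :: "'a::comm_ring_1 ^ 'n ^ 'n \<Rightarrow> 'a poly" where
  "charpoly A = det (mat [:0, 1:] - (\<chi> i j. [:A $ i $ j:]))"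

text \<open>
  The roots of the characteristic polynomial in the field of entries, with their
  algebraic multiplicities. A real symmetric matrix has only real eigenvalues, so
  for the Randic matrix this multiset consists of all \<open>CARD('v)\<close> eigenvalues.
\<close>

definition eigenvalues :: "'a::field ^ 'n ^ 'n \<Rightarrow> 'a multiset" where
  "eigenvalues A = proots (charpoly A)"

definition randic_energy :: "('v::finite \<Rightarrow> 'v \<Rightarrow> bool) \<Rightarrow> real" where
  "randic_energy E = (\<Sum>x\<in>#eigenvalues (randic_matrix E). \<bar>x\<bar>)"

definition nullity :: "real ^ 'n ^ 'm \<Rightarrow> nat" where
  "nullity A = dim {x. A *v x = 0}"

end

theory Submission
  imports Defs
begin

text \<open>
  Write \<open>d\<^sub>u\<close> for the degree of \<open>u\<close>. The vector with entries \<open>sqrt d\<^sub>u\<close> is fixed by the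
  Randic matrix \<open>R\<close>, so \<open>1\<close> is an eigenvalue. Setting one copy of it aside, at most
  \<open>n - 1 - null(R)\<close> nonzero eigenvalues remain, and their squares sum to
  \<open>trace(R\<^sup>2) - 1\<close>. The Cauchy-Schwarz inequality therefore gives
  \<open>RE(G) \<le> 1 + sqrt (n - 1 - null(R)) * sqrt (trace(R\<^sup>2) - 1)\<close>
  (\<open>sum_abs_eigenvalues_le\<close>), and it remains to show \<open>trace(R\<^sup>2) \<le> n/2\<close>.

  The trace of \<open>R\<^sup>2\<close> is the sum of \<open>1/(d\<^sub>u d\<^sub>v)\<close> over all ordered pairs of adjacent vertices.
  In a connected graph on at least three vertices, an edge whose end degrees sum to less
  than \<open>4\<close> has end degrees \<open>1\<close> and \<open>2\<close>, and so it starts a suspended path. Without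
  suspended paths, every edge \<open>uv\<close> thus satisfies \<open>d\<^sub>u + d\<^sub>v \<ge> 4\<close>
  (\<open>four_le_degree_sum\<close>), which is the same as
  \<open>1/(d\<^sub>u d\<^sub>v) \<le> (1/d\<^sub>u + 1/d\<^sub>v)/4\<close>. Summed over the ordered pairs, \<open>1/d\<^sub>u\<close> contributes
  \<open>d\<^sub>u * (1/d\<^sub>u) = 1\<close> for each vertex \<open>u\<close>, hence \<open>n\<close> in total, and likewise \<open>1/d\<^sub>v\<close>; so the
  right-hand sides sum to \<open>n/2\<close> (\<open>sum_squares_randic_matrix_le\<close>).

  The eigenvalues are roots of the characteristic polynomial, whereas the argument needs
  them as the diagonal entries of an orthogonally diagonalized matrix. The connection is
  the spectral theorem \<open>symmetric_matrix_diagonalization\<close>, which rests on maximizing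
  the quadratic form \<open>x \<bullet> f x\<close> over unit spheres of invariant subspaces.
\<close>

section \<open>Diagonalization of real symmetric matrices\<close>

text \<open>
  Near \<open>t = 0\<close> a nonzero linear term dominates any quadratic one. This is the first-order
  condition at a maximum, in a form that avoids derivatives.
\<close>

lemma linear_coefficient_zero_if_quadratically_bounded:
  fixes a c :: real
  assumes "\<And>t. 2 * t * a \<le> t\<^sup>2 * c"
  shows "a = 0"
proof (rule ccontr)
  assume "a \<noteq> 0"
  define C where "C = \<bar>c\<bar> + 1"
  have C: "C > 0" "c < C"
    by (auto simp: C_def)
  \<comment> \<open>The bound already fails at this \<open>t\<close>, which has the sign of \<open>a\<close> and is small enough since \<open>C > c\<close>.\<close>
  have "2 * (a / C) * a \<le> (a / C)\<^sup>2 * c"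
    by (rule assms)
  then have "2 * a\<^sup>2 * C \<le> a\<^sup>2 * c"
    using C by (simp add: field_simps power2_eq_square)
  then have "2 * C \<le> c"
    using \<open>a \<noteq> 0\<close> by (simp add: mult.assoc mult.left_commute)
  then show False
    using C by linarith
qed

text \<open>
  A unit vector \<open>v\<close> of \<open>S\<close> that maximizes \<open>x \<bullet> f x\<close> is an eigenvector: moving \<open>v\<close> in the
  direction of the component \<open>w\<close> of \<open>f v\<close> orthogonal to \<open>v\<close> changes the quadratic form to
  first order by \<open>2 t (w \<bullet> w)\<close>, so maximality forces \<open>w = 0\<close>.
\<close>

lemma self_adjoint_eigenvector_in_invariant_subspace:
  fixes f :: "'a::euclidean_space \<Rightarrow> 'a"
  assumes lin: "linear f" and adj: "\<And>x y. f x \<bullet> y = x \<bullet> f y"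
    and S: "subspace S" "f ` S \<subseteq> S" "S \<noteq> {0}"
  obtains v \<mu> where "v \<in> S" "norm v = 1" "f v = \<mu> *\<^sub>R v"
proof -
  define K where "K = S \<inter> sphere 0 1"
  have "compact K"
    unfolding K_def by (simp add: S(1) closed_subspace closed_Int_compact)
  obtain x where x: "x \<in> S" "x \<noteq> 0"
    using S(1,3) subspace_0 by blast
  have "x /\<^sub>R norm x \<in> K"
    using x S(1) by (auto simp: K_def subspace_scale)
  then have "K \<noteq> {}"
    by blast
  have "continuous_on K (\<lambda>x. x \<bullet> f x)"
    by (intro continuous_intros linear_continuous_on) (use lin in \<open>simp add: linear_conv_bounded_linear\<close>)
  then obtain v where v: "v \<in> K" and max: "\<And>y. y \<in> K \<Longrightarrow> y \<bullet> f y \<le> v \<bullet> f v"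
    using continuous_attains_sup[OF \<open>compact K\<close> \<open>K \<noteq> {}\<close>] by blast
  define \<mu> where "\<mu> = v \<bullet> f v"
  have vS: "v \<in> S" and nv: "norm v = 1"
    using v by (auto simp: K_def)
  have vv: "v \<bullet> v = 1"
    using nv by (simp add: dot_square_norm)
  have bound: "y \<bullet> f y \<le> \<mu> * (y \<bullet> y)" if "y \<in> S" for y
  proof (cases "y = 0")
    case False
    have "y /\<^sub>R norm y \<in> K"
      using that False S(1) by (auto simp: K_def subspace_scale)
    from max[OF this] have "(y \<bullet> f y) / (norm y)\<^sup>2 \<le> \<mu>"
      by (simp add: \<mu>_def linear_scale[OF lin] divide_inverse power2_eq_square mult_ac)
    then show ?thesis
      using False by (simp add: divide_le_eq dot_square_norm)
  qed (use linear_0[OF lin] in simp)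
  define w where "w = f v - \<mu> *\<^sub>R v"
  have wS: "w \<in> S"
    unfolding w_def using S vS by (auto intro!: subspace_diff subspace_scale)
  have wv: "w \<bullet> v = 0"
    by (simp add: w_def inner_diff_left inner_diff_right vv \<mu>_def inner_commute)
  have "w \<bullet> w = w \<bullet> (f v - \<mu> *\<^sub>R v)"
    by (simp only: w_def)
  then have wfv: "w \<bullet> f v = w \<bullet> w"
    by (simp add: inner_diff_right wv)
  have "w \<bullet> w = 0"
  proof (rule linear_coefficient_zero_if_quadratically_bounded)
    fix t :: real
    have "(v + t *\<^sub>R w) \<bullet> f (v + t *\<^sub>R w) = \<mu> + 2 * t * (w \<bullet> f v) + t\<^sup>2 * (w \<bullet> f w)"
      using adj[of v w] by (simp add: linear_add[OF lin] linear_scale[OF lin] inner_add_left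
          inner_add_right \<mu>_def power2_eq_square algebra_simps inner_commute)
    moreover have "(v + t *\<^sub>R w) \<bullet> (v + t *\<^sub>R w) = 1 + t\<^sup>2 * (w \<bullet> w)"
      using wv vv by (simp add: inner_add_left inner_add_right power2_eq_square inner_commute)
    moreover have "v + t *\<^sub>R w \<in> S"
      using S(1) vS wS by (simp add: subspace_add subspace_scale)
    ultimately have "\<mu> + 2 * t * (w \<bullet> f v) + t\<^sup>2 * (w \<bullet> f w) \<le> \<mu> * (1 + t\<^sup>2 * (w \<bullet> w))"
      using bound by metis
    then show "2 * t * (w \<bullet> w) \<le> t\<^sup>2 * (\<mu> * (w \<bullet> w) - w \<bullet> f w)"
      by (simp add: wfv algebra_simps)
  qed
  then have "f v = \<mu> *\<^sub>R v"
    by (simp add: w_def)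
  then show thesis
    using that vS nv by blast
qed

text \<open>
  The orthogonal complement of an eigenvector of a self-adjoint map is again invariant, so
  eigenvectors can be split off one at a time, by induction on the dimension.
\<close>

lemma self_adjoint_orthonormal_eigenbasis:
  fixes f :: "'a::euclidean_space \<Rightarrow> 'a"
  assumes lin: "linear f" and adj: "\<And>x y. f x \<bullet> y = x \<bullet> f y"
    and "subspace S" "f ` S \<subseteq> S"
  shows "\<exists>B. pairwise orthogonal B \<and> (\<forall>b\<in>B. norm b = 1 \<and> (\<exists>\<mu>. f b = \<mu> *\<^sub>R b)) \<and> span B = S"
  using assms(3,4)
proof (induction "dim S" arbitrary: S rule: less_induct)
  case less
  show ?case
  proof (cases "S = {0}")
    case True
    then show ?thesis
      by (intro exI[of _ "{}"]) auto
  next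
    case False
    obtain v \<mu> where v: "v \<in> S" "norm v = 1" "f v = \<mu> *\<^sub>R v"
      using self_adjoint_eigenvector_in_invariant_subspace[OF lin adj less.prems False] by blast
    define T where "T = S \<inter> {x. v \<bullet> x = 0}"
    have subT: "subspace T"
      unfolding T_def by (intro subspace_inter less.prems(1) subspace_hyperplane)
    have "v \<notin> T"
      using v(2) by (auto simp: T_def)
    then have "T \<subset> S"
      using v(1) unfolding T_def by blast
    then have "dim T < dim S"
      using subT less.prems(1) by (metis dim_psubset span_eq_iff)
    moreover have "f ` T \<subseteq> T"
    proof -
      have "v \<bullet> f x = \<mu> * (v \<bullet> x)" for x
        using adj[of v x] v(3) by simp
      then show ?thesis
        using less.prems(2) by (auto simp: T_def)
    qed
    ultimately obtain B where B: "pairwise orthogonal B"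
        "\<forall>b\<in>B. norm b = 1 \<and> (\<exists>\<mu>. f b = \<mu> *\<^sub>R b)" "span B = T"
      using less.hyps subT by blast
    have "orthogonal v b" if "b \<in> B" for b
      using that B(3) span_base[of b B] by (auto simp: T_def orthogonal_def)
    then have "pairwise orthogonal (insert v B)"
      using B(1) by (auto simp: pairwise_insert orthogonal_commute)
    moreover have "span (insert v B) = S"
    proof
      show "span (insert v B) \<subseteq> S"
        using v(1) B(3) less.prems(1) span_superset[of B] by (intro span_minimal) (auto simp: T_def)
      show "S \<subseteq> span (insert v B)"
      proof
        fix x assume "x \<in> S"
        then have "x - (v \<bullet> x) *\<^sub>R v \<in> T"
          using v(1,2) less.prems(1)
          by (auto simp: T_def subspace_diff subspace_scale inner_diff_right dot_square_norm)
        then show "x \<in> span (insert v B)"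
          unfolding span_insert B(3) by blast
      qed
    qed
    ultimately show ?thesis
      using B(2) v by (intro exI[of _ "insert v B"]) auto
  qed
qed

definition diagonal_matrix :: "('n \<Rightarrow> 'a::zero) \<Rightarrow> 'a ^ 'n ^ 'n" where
  "diagonal_matrix d = (\<chi> i j. if i = j then d i else 0)"

lemma matrix_mult_diagonal_matrix:
  fixes P :: "'a::comm_ring_1 ^ 'n ^ 'm"
  shows "P ** diagonal_matrix d = (\<chi> i j. P $ i $ j * d j)"
  by (simp add: matrix_matrix_mult_def diagonal_matrix_def vec_eq_iff if_distrib[of "(*) _"]
      cong: if_cong)

text \<open>
  The columns of \<open>P\<close> are an orthonormal eigenbasis of \<open>A\<close>, listed along an arbitrary
  bijection from the index type.
\<close>

theorem symmetric_matrix_diagonalization: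
  fixes A :: "real ^ 'n ^ 'n"
  assumes sym: "transpose A = A"
  obtains P d where "orthogonal_matrix P" "A ** P = P ** diagonal_matrix d"
proof -
  have adj: "(A *v x) \<bullet> y = x \<bullet> (A *v y)" for x y
    using dot_lmul_matrix[of x A y] sym by (metis transpose_matrix_vector)
  obtain B where B: "pairwise orthogonal B"
      "\<forall>b\<in>B. norm b = 1 \<and> (\<exists>\<mu>. A *v b = \<mu> *\<^sub>R b)" "span B = (UNIV :: (real ^ 'n) set)"
    using self_adjoint_orthonormal_eigenbasis[of "(*v) A" UNIV] adj by auto
  have ind: "independent B"
    using B by (intro pairwise_orthogonal_independent) auto
  then have "card B = CARD('n)"
    using dim_eq_card[of B UNIV] B(3) by (simp add: dim_UNIV)
  moreover have "finite B"
    using ind by (simp add: independent_bound)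
  ultimately obtain b where b: "bij_betw b (UNIV :: 'n set) B"
    using finite_same_card_bij[of "UNIV :: 'n set" B] by auto
  then have bB: "b i \<in> B" and inj_b: "inj b" for i
    by (auto simp: bij_betw_def)
  have "\<forall>i. \<exists>\<mu>. A *v b i = \<mu> *\<^sub>R b i"
    using B(2) bB by blast
  then obtain d where d: "A *v b i = d i *\<^sub>R b i" for i
    by metis
  define P :: "real ^ 'n ^ 'n" where "P = (\<chi> i j. b j $ i)"
  have col: "column i P = b i" for i
    by (simp add: P_def column_def vec_eq_iff)
  have "orthogonal_matrix P"
    unfolding orthogonal_matrix_orthonormal_columns col
    using B(1,2) bB inj_b by (simp add: pairwise_def inj_eq)
  moreover have "A ** P = P ** diagonal_matrix d"
  proof -
    have "(A ** P) $ i $ j = (A *v b j) $ i" for i j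
      by (simp add: matrix_matrix_mult_def matrix_vector_mult_def P_def)
    then show ?thesis
      by (simp add: matrix_mult_diagonal_matrix d vec_eq_iff P_def mult.commute)
  qed
  ultimately show thesis
    using that by blast
qed

section \<open>Eigenvalues, nullity and trace from a diagonalization\<close>

text \<open>
  Similar matrices have the same characteristic polynomial. The conjugation takes place
  over the polynomial ring, to which \<open>A\<close> and \<open>P\<close> are lifted with constant entries.
\<close>

lemma eigenvalues_of_diagonalization:
  fixes A P :: "'a::field ^ 'n ^ 'n"
  assumes inv: "Q ** P = mat 1" and AP: "A ** P = P ** diagonal_matrix d"
  shows "eigenvalues A = image_mset d (mset_set UNIV)"
proof -
  define lift :: "'a ^ 'n ^ 'n \<Rightarrow> 'a poly ^ 'n ^ 'n" where
    "lift M = (\<chi> i j. [:M $ i $ j:])" for M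
  have const_sum: "(\<Sum>i\<in>I. [:g i:]) = [:sum g I:]" for g :: "'n \<Rightarrow> 'a" and I
    by (induction I rule: infinite_finite_induct) auto
  have lift_mult: "lift M ** lift N = lift (M ** N)" for M N
    by (simp add: lift_def matrix_matrix_mult_def vec_eq_iff const_sum mult.commute)
  have "lift Q ** lift P = mat 1"
    unfolding lift_mult inv by (simp add: lift_def mat_def vec_eq_iff one_pCons)
  then have "det (lift Q) * det (lift P) = 1"
    by (metis det_I det_mul)
  then have "det (lift P) \<noteq> 0"
    by auto
  let ?X = "mat [:0, 1:] :: 'a poly ^ 'n ^ 'n"
  have X_comm: "?X ** lift P = lift P ** ?X"
    by (simp add: matrix_matrix_mult_def mat_def vec_eq_iff if_distrib[of "\<lambda>x. x * _"]
        if_distrib[of "(*) _"] mult.commute cong: if_cong)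
  have "(?X - lift A) ** lift P = ?X ** lift P - lift (A ** P)"
    unfolding lift_mult[symmetric]
    by (simp add: matrix_matrix_mult_def vec_eq_iff sum_subtractf left_diff_distrib)
  also have "\<dots> = lift P ** (?X - lift (diagonal_matrix d))"
    unfolding AP X_comm lift_mult[symmetric]
    by (simp add: matrix_matrix_mult_def vec_eq_iff sum_subtractf right_diff_distrib)
  finally have "det (?X - lift A) * det (lift P) =
      det (?X - lift (diagonal_matrix d)) * det (lift P)"
    by (metis det_mul mult.commute)
  then have "charpoly A = det (?X - lift (diagonal_matrix d))"
    using \<open>det (lift P) \<noteq> 0\<close> by (simp add: charpoly_def lift_def)
  also have "\<dots> = (\<Prod>i\<in>UNIV. [:- d i, 1:])"
    by (subst det_diagonal) (auto simp: lift_def diagonal_matrix_def mat_def)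
  finally show ?thesis
    by (simp add: eigenvalues_def proots_prod sum_unfold_sum_mset)
qed

text \<open>
  In the coordinates \<open>y\<close> of \<open>x\<close> with respect to the columns of \<open>P\<close>, the equation
  \<open>A x = 0\<close> reads \<open>d i * y i = 0\<close>; so the columns with \<open>d i = 0\<close> span the kernel.
\<close>

lemma nullity_le_card_zero_diagonal:
  fixes A P :: "real ^ 'n ^ 'n"
  assumes orth: "orthogonal_matrix P" and AP: "A ** P = P ** diagonal_matrix d"
  shows "nullity A \<le> card {i. d i = 0}"
proof -
  have inv: "P ** transpose P = mat 1" "transpose P ** P = mat 1"
    using orth by (auto simp: orthogonal_matrix_def)
  have "x \<in> span ((\<lambda>i. column i P) ` {i. d i = 0})" if "A *v x = 0" for x
  proof -
    define y where "y = transpose P *v x"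
    have x: "x = P *v y"
      unfolding y_def matrix_vector_mul_assoc inv by simp
    have "(P ** diagonal_matrix d) *v y = 0"
      using that unfolding x matrix_vector_mul_assoc AP .
    then have "diagonal_matrix d *v y = 0"
      by (metis inv(2) matrix_vector_mul_assoc matrix_vector_mul_lid matrix_vector_mult_0_right)
    then have "d i * y $ i = 0" for i
      by (simp add: diagonal_matrix_def matrix_vector_mult_def vec_eq_iff
          if_distrib[of "\<lambda>x. x * _"] cong: if_cong)
    then have y0: "y $ i = 0" if "d i \<noteq> 0" for i
      using that by (metis mult_eq_0_iff)
    have "x = (\<Sum>i\<in>UNIV. y $ i *\<^sub>R column i P)"
      unfolding x by (simp add: matrix_vector_mult_def column_def vec_eq_iff mult.commute)
    also have "\<dots> = (\<Sum>i\<in>{i. d i = 0}. y $ i *\<^sub>R column i P)"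
      using y0 by (intro sum.mono_neutral_right) auto
    finally have x_sum: "x = (\<Sum>i\<in>{i. d i = 0}. y $ i *\<^sub>R column i P)" .
    show ?thesis
      unfolding x_sum by (intro span_sum span_scale span_base) auto
  qed
  then have "nullity A \<le> card ((\<lambda>i. column i P) ` {i. d i = 0})"
    unfolding nullity_def by (intro dim_le_card) auto
  also have "\<dots> \<le> card {i. d i = 0}"
    by (rule card_image_le) simp
  finally show ?thesis .
qed

text \<open>
  Both sides are the trace of \<open>A\<^sup>2\<close>, which is invariant under conjugation by \<open>P\<close>.
\<close>

lemma sum_squares_diagonal_eq_sum_squares_entries:
  fixes A P :: "real ^ 'n ^ 'n"
  assumes sym: "transpose A = A"
    and orth: "orthogonal_matrix P" and AP: "A ** P = P ** diagonal_matrix d"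
  shows "(\<Sum>i\<in>UNIV. (d i)\<^sup>2) = (\<Sum>i\<in>UNIV. \<Sum>j\<in>UNIV. (A $ i $ j)\<^sup>2)"
proof -
  let ?D = "diagonal_matrix d"
  have inv: "P ** transpose P = mat 1" "transpose P ** P = mat 1"
    using orth by (auto simp: orthogonal_matrix_def)
  have A_sym: "A $ j $ i = A $ i $ j" for i j
    using sym by (metis transpose_def vec_lambda_beta)
  have "(\<Sum>i\<in>UNIV. (d i)\<^sup>2) = trace (?D ** ?D)"
    unfolding matrix_mult_diagonal_matrix
    by (simp add: trace_def diagonal_matrix_def power2_eq_square)
  also have "?D ** ?D = transpose P ** ((A ** A) ** P)"
    by (metis AP inv(2) matrix_mul_assoc matrix_mul_lid)
  also have "trace \<dots> = trace (A ** A)"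
    by (metis inv(1) matrix_mul_assoc matrix_mul_rid trace_mul_sym)
  also have "\<dots> = (\<Sum>i\<in>UNIV. \<Sum>j\<in>UNIV. (A $ i $ j)\<^sup>2)"
    by (simp add: trace_def matrix_matrix_mult_def power2_eq_square A_sym)
  finally show ?thesis .
qed

lemma eigenvalue_on_diagonal:
  fixes A P :: "real ^ 'n ^ 'n"
  assumes orth: "orthogonal_matrix P" and AP: "A ** P = P ** diagonal_matrix d"
    and x: "A *v x = c *\<^sub>R x" "x \<noteq> 0"
  obtains i where "d i = c"
proof -
  have inv: "P ** transpose P = mat 1" "transpose P ** P = mat 1"
    using orth by (auto simp: orthogonal_matrix_def)
  define y where "y = transpose P *v x"
  have xy: "x = P *v y"
    unfolding y_def matrix_vector_mul_assoc inv by simp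
  then have "y \<noteq> 0"
    using x(2) by (metis matrix_vector_mult_0_right)
  then obtain i where i: "y $ i \<noteq> 0"
    by (auto simp: vec_eq_iff)
  have "diagonal_matrix d = transpose P ** (A ** P)"
    by (simp add: AP matrix_mul_assoc inv)
  then have "diagonal_matrix d *v y = transpose P *v (A *v x)"
    by (simp add: xy matrix_vector_mul_assoc matrix_mul_assoc)
  also have "\<dots> = c *\<^sub>R y"
    by (simp add: x(1) y_def matrix_vector_mult_scaleR)
  finally have "(diagonal_matrix d *v y) $ i = c * y $ i"
    by simp
  then have "d i * y $ i = c * y $ i"
    by (simp add: diagonal_matrix_def matrix_vector_mult_def if_distrib[of "\<lambda>x. x * _"]
        cong: if_cong)
  then show thesis
    using i that by simp
qed

text \<open>
  The eigenvalue \<open>1\<close> of the fixed vector is taken out once, the zero eigenvalues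
  contribute nothing, and Cauchy-Schwarz is applied to what is left. The bound improves on
  a direct application to all eigenvalues because the position of \<open>1\<close> leaves both the
  count and the sum of squares.
\<close>

theorem sum_abs_eigenvalues_le:
  fixes A :: "real ^ 'n ^ 'n"
  assumes sym: "transpose A = A" and x: "A *v x = x" "x \<noteq> 0"
    and S: "(\<Sum>i\<in>UNIV. \<Sum>j\<in>UNIV. (A $ i $ j)\<^sup>2) \<le> S"
  shows "(\<Sum>\<mu>\<in>#eigenvalues A. \<bar>\<mu>\<bar>) \<le>
    1 + sqrt (real CARD('n) - 1 - real (nullity A)) * sqrt (S - 1)"
proof -
  obtain P d where orth: "orthogonal_matrix P" and AP: "A ** P = P ** diagonal_matrix d"
    using symmetric_matrix_diagonalization[OF sym] by blast
  obtain k where k: "d k = 1"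
    using eigenvalue_on_diagonal[OF orth AP, of x 1] x by auto
  define Z where "Z = {i. d i = 0}"
  define N where "N = - Z - {k}"
  have kZ: "k \<notin> Z"
    using k by (simp add: Z_def)
  have split: "(\<Sum>i\<in>UNIV. g (d i)) = g 1 + (\<Sum>i\<in>N. g (d i))" if "g 0 = 0" for g :: "real \<Rightarrow> real"
  proof -
    have "(\<Sum>i\<in>UNIV. g (d i)) = (\<Sum>i\<in>insert k N. g (d i))"
      using that by (intro sum.mono_neutral_right) (auto simp: N_def Z_def)
    also have "\<dots> = g (d k) + (\<Sum>i\<in>N. g (d i))"
      by (rule sum.insert) (auto simp: N_def)
    finally show ?thesis
      by (simp only: k)
  qed
  have "card (- Z) = CARD('n) - card Z"
    by (simp add: Compl_eq_Diff_UNIV card_Diff_subset)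
  then have "card N = CARD('n) - card Z - 1"
    using kZ by (simp add: N_def)
  moreover have "card Z < CARD('n)"
    using kZ by (intro psubset_card_mono) auto
  moreover have "nullity A \<le> card Z"
    unfolding Z_def by (rule nullity_le_card_zero_diagonal[OF orth AP])
  ultimately have cardN: "real (card N) \<le> real CARD('n) - 1 - real (nullity A)"
    by linarith
  have "(\<Sum>\<mu>\<in>#eigenvalues A. \<bar>\<mu>\<bar>) = (\<Sum>i\<in>UNIV. \<bar>d i\<bar>)"
    using eigenvalues_of_diagonalization[of "transpose P", OF _ AP] orth
    by (simp add: orthogonal_matrix image_mset.compositionality o_def sum_unfold_sum_mset)
  also have "\<dots> = 1 + (\<Sum>i\<in>N. \<bar>d i\<bar>)"
    using split[of abs] by simp
  also have "(\<Sum>i\<in>N. \<bar>d i\<bar>) \<le> sqrt (card N) * sqrt (\<Sum>i\<in>N. (d i)\<^sup>2)"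
    using L2_set_mult_ineq[of "\<lambda>_. 1" d N] by (simp add: L2_set_def)
  also have "\<dots> \<le> sqrt (real CARD('n) - 1 - real (nullity A)) * sqrt (S - 1)"
  proof (intro mult_mono real_sqrt_le_mono cardN)
    show "(\<Sum>i\<in>N. (d i)\<^sup>2) \<le> S - 1"
      using split[of power2] sum_squares_diagonal_eq_sum_squares_entries[OF sym orth AP] S by simp
  qed (use cardN in \<open>auto intro: sum_nonneg\<close>)
  finally show ?thesis
    by simp
qed

section \<open>The Randic matrix\<close>

lemma randic_matrix_symmetric:
  assumes "simple_graph E"
  shows "transpose (randic_matrix E) = randic_matrix E"
  using assms by (auto simp: simple_graph_def randic_matrix_def transpose_def vec_eq_iff
      mult.commute dest: sympD)

lemma connected_degree_pos:
  fixes E :: "'v::finite \<Rightarrow> 'v \<Rightarrow> bool"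
  assumes "connected_graph E" "CARD('v) \<ge> 2"
  shows "degree E u > 0"
proof -
  obtain v where "v \<noteq> u"
    using assms(2) by (metis One_nat_def UNIV_eq_I insert_iff Suc_1 not_less_eq_eq le_refl
        card_1_singleton_iff)
  moreover have "E\<^sup>*\<^sup>* u v"
    using assms(1) by (simp add: connected_graph_def)
  ultimately obtain w where "E u w"
    by (metis converse_rtranclpE)
  then show ?thesis
    unfolding degree_def by (subst card_gt_0_iff) auto
qed

text \<open>
  Each of the \<open>d\<^sub>u\<close> neighbours \<open>v\<close> of \<open>u\<close> contributes
  \<open>sqrt d\<^sub>v / sqrt (d\<^sub>u d\<^sub>v) = 1 / sqrt d\<^sub>u\<close>.
\<close>

lemma randic_matrix_fixes_sqrt_degree:
  assumes "simple_graph E" and pos: "\<And>u. degree E u > 0"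
  shows "randic_matrix E *v (\<chi> u. sqrt (degree E u)) = (\<chi> u. sqrt (degree E u))"
proof -
  have "(\<Sum>v\<in>UNIV. randic_matrix E $ u $ v * sqrt (degree E v)) = sqrt (degree E u)" for u
  proof -
    have "(\<Sum>v\<in>UNIV. randic_matrix E $ u $ v * sqrt (degree E v)) =
        (\<Sum>v\<in>UNIV. if E u v then 1 / sqrt (degree E u) else 0)"
      using pos by (intro sum.cong) (auto simp: randic_matrix_def real_sqrt_mult dest: less_imp_neq)
    also have "\<dots> = degree E u / sqrt (degree E u)"
      by (simp add: degree_def flip: sum.inter_filter)
    also have "\<dots> = sqrt (degree E u)"
      by (simp add: real_div_sqrt)
    finally show ?thesis .
  qed
  then show ?thesis
    by (simp add: matrix_vector_mult_def vec_eq_iff)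
qed

lemma degree_one_neighbour_unique:
  assumes "degree E u = 1" "E u v" "E u w"
  shows "v = w"
proof -
  obtain x where "{v. E u v} = {x}"
    using assms(1) unfolding degree_def by (rule card_1_singletonE)
  then show ?thesis
    using assms(2,3) by (metis mem_Collect_eq singletonD)
qed

text \<open>
  Only the neighbour \<open>y\<close> of a pendent vertex \<open>x\<close> matters: it has degree at least \<open>3\<close>. Degree
  \<open>1\<close> would make \<open>{x, y}\<close> a whole component, and degree \<open>2\<close> would make the other neighbour
  of \<open>y\<close> the end of a suspended path.
\<close>

lemma four_le_degree_sum:
  fixes E :: "'v::finite \<Rightarrow> 'v \<Rightarrow> bool"
  assumes simple: "simple_graph E" and conn: "connected_graph E" and card: "CARD('v) \<ge> 3"
    and no_susp: "\<not> (\<exists>u v w. suspended_path E u v w)"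
    and uv: "E u v"
  shows "4 \<le> degree E u + degree E v"
proof -
  have sym: "E x y \<Longrightarrow> E y x" and irrefl: "\<not> E x x" for x y
    using simple by (auto simp: simple_graph_def dest: sympD irreflpD)
  have pos: "degree E x > 0" for x
    using connected_degree_pos[OF conn] card by simp
  have pendant: "degree E y \<ge> 3" if xy: "E x y" and deg: "degree E x = 1" for x y
  proof (rule ccontr)
    assume "\<not> 3 \<le> degree E y"
    then consider "degree E y = 1" | "degree E y = 2"
      using pos[of y] by linarith
    then show False
    proof cases
      case 1
      have "z \<in> {x, y}" if "E\<^sup>*\<^sup>* x z" for z
        using that
      proof induction
        case (step z z')
        then show ?case
          using degree_one_neighbour_unique[OF deg xy, of z']
            degree_one_neighbour_unique[OF 1 sym[OF xy], of z'] by auto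
      qed simp
      then have "UNIV \<subseteq> {x, y}"
        using conn by (auto simp: connected_graph_def)
      then have "CARD('v) \<le> card {x, y}"
        by (intro card_mono) auto
      also have "\<dots> \<le> 2"
        by (simp add: card_insert_if)
      finally show False
        using card by simp
    next
      case 2
      have "card ({w. E y w} - {x}) = 1"
        using 2 sym[OF xy] by (simp add: degree_def)
      then obtain w where "w \<in> {w. E y w} - {x}"
        by (metis card_1_singletonE insertI1)
      then have "suspended_path E x y w"
        using xy deg 2 irrefl by (auto simp: suspended_path_def)
      then show False
        using no_susp by blast
    qed
  qed
  show ?thesis
    using pendant[OF uv] pendant[OF sym[OF uv]] pos[of u] pos[of v] by linarith
qed

lemma inverse_product_le:
  fixes a b :: real
  assumes "a > 0" "b > 0" "a + b \<ge> 4"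
  shows "1 / (a * b) \<le> (1 / a + 1 / b) / 4"
  using assms by (simp add: field_simps)

text \<open>
  Every vertex distributes the weight \<open>1\<close> equally over its incident edges, an edge \<open>uv\<close>
  receiving \<open>1/d\<^sub>u + 1/d\<^sub>v\<close>. By the degree condition this is at least four times
  \<open>1/(d\<^sub>u d\<^sub>v)\<close>; each edge occurs in two entries of the matrix, so the sum of the squared
  entries is at most \<open>2/4\<close> of the total weight \<open>n\<close>.
\<close>

lemma sum_squares_randic_matrix_le:
  fixes E :: "'v::finite \<Rightarrow> 'v \<Rightarrow> bool"
  assumes simple: "simple_graph E" and pos: "\<And>u. degree E u > 0"
    and four: "\<And>u v. E u v \<Longrightarrow> 4 \<le> degree E u + degree E v"
  shows "(\<Sum>u\<in>UNIV. \<Sum>v\<in>UNIV. (randic_matrix E $ u $ v)\<^sup>2) \<le> real CARD('v) / 2"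
proof -
  have row: "(\<Sum>v\<in>UNIV. if E u v then 1 / real (degree E u) else 0) = 1" for u
    using pos[of u] by (auto simp: degree_def card_gt_0_iff simp flip: sum.inter_filter)
  have "E v u \<longleftrightarrow> E u v" for u v
    using simple by (auto simp: simple_graph_def dest: sympD)
  then have col: "(\<Sum>u\<in>UNIV. if E u v then 1 / real (degree E v) else 0) = 1" for v
    using row[of v] by simp
  have "(randic_matrix E $ u $ v)\<^sup>2 \<le>
      (if E u v then 1 / real (degree E u) else 0) / 4 +
      (if E u v then 1 / real (degree E v) else 0) / 4" for u v
  proof (cases "E u v")
    case True
    have "4 \<le> real (degree E u) + real (degree E v)"
      using four[OF True] by linarith
    then show ?thesis
      using True inverse_product_le[of "real (degree E u)" "real (degree E v)"] pos
      by (simp add: randic_matrix_def power_divide add_divide_distrib)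
  qed (simp add: randic_matrix_def)
  then have "(\<Sum>u\<in>UNIV. \<Sum>v\<in>UNIV. (randic_matrix E $ u $ v)\<^sup>2) \<le>
      (\<Sum>u\<in>UNIV. \<Sum>v\<in>UNIV. (if E u v then 1 / real (degree E u) else 0) / 4 +
        (if E u v then 1 / real (degree E v) else 0) / 4)"
    by (intro sum_mono)
  also have "\<dots> = (\<Sum>u\<in>UNIV. \<Sum>v\<in>UNIV. if E u v then 1 / real (degree E u) else 0) / 4 +
      (\<Sum>v\<in>UNIV. \<Sum>u\<in>UNIV. if E u v then 1 / real (degree E v) else 0) / 4"
    by (subst (2) sum.swap) (simp only: sum.distrib sum_divide_distrib)
  also have "\<dots> = real CARD('v) / 2"
    by (simp only: row col) simp
  finally show ?thesis .
qed

theorem theorem4p8: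
  fixes E :: "'v::finite \<Rightarrow> 'v \<Rightarrow> bool"
  assumes "simple_graph E"
    and "connected_graph E"
    and "CARD('v) \<ge> 3"
    and "\<not> (\<exists>u v w. suspended_path E u v w)"
  shows "randic_energy E \<le>
    sqrt (real CARD('v) - 1 - real (nullity (randic_matrix E))) *
    sqrt (real CARD('v) - 2) * (sqrt 2 / 2) + 1"
proof -
  let ?R = "randic_matrix E"
  let ?null = "real CARD('v) - 1 - real (nullity ?R)"
  let ?x = "\<chi> u. sqrt (degree E u)"
  have pos: "degree E u > 0" for u
    using connected_degree_pos[OF assms(2)] assms(3) by simp
  have "randic_energy E \<le> 1 + sqrt ?null * sqrt (real CARD('v) / 2 - 1)"
    unfolding randic_energy_def
  proof (rule sum_abs_eigenvalues_le)
    show "?R *v ?x = ?x"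
      using randic_matrix_fixes_sqrt_degree[OF assms(1) pos] .
    show "?x \<noteq> 0"
      using pos by (auto simp: vec_eq_iff dest: less_imp_neq)
    show "(\<Sum>u\<in>UNIV. \<Sum>v\<in>UNIV. (?R $ u $ v)\<^sup>2) \<le> real CARD('v) / 2"
      using sum_squares_randic_matrix_le[OF assms(1) pos four_le_degree_sum[OF assms]] .
  qed (rule randic_matrix_symmetric[OF assms(1)])
  also have "sqrt (real CARD('v) / 2 - 1) = sqrt (real CARD('v) - 2) * (sqrt 2 / 2)"
    proof -
    have "real CARD('v) / 2 - 1 = (real CARD('v) - 2) * (2 / 4)"
      by simp
    then show ?thesis
      by (simp only: real_sqrt_mult real_sqrt_divide real_sqrt_four)
  qed
  finally show ?thesis
    by (simp add: mult.assoc)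
qed

end
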